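(* Let $\theta,\theta'\in\overline L^2_{\mathcal F}(t_0-l,t_0)$ with $\theta_{t_0},\theta'_{t_0}\in L^2(\mathcal F_{t_0})$. Let $b,b':\Omega\times[0,T]\times\overline L^2_{\mathcal F}(t_0-l,T+u)\to\mathbf R$ be such that for each $\mathbf x\in\overline L^2_{\mathcal F}(t_0-l,T+u)$, $b(\cdot,\mathbf x),b'(\cdot,\mathbf x)\in L^2_{\mathcal F}(0,T)$ (in particular progressively measurable) and $b(t,\mathbf x)$, $b'(t,\mathbf x)$ are continuous in $t$. Suppose that $h=b$ and $h=b'$ both satisfy: there are a constant $K_2>0$ and a probability measure $\lambda_1$ on $[-l,u]$ such that for each $t\in[t_0,T]$ and all $\mathbf x,\tilde{\mathbf x}\in\overline L^2_{\mathcal F}(t_0-l,T+u)$, $$|h(t,\mathbf x)-h(t,\tilde{\mathbf x})|\le K_2E\Big[\int_{-l}^u|x_{t+r}-\tilde x_{t+r}|\lambda_1(dr)\,\Big|\,\mathcal F_t\Big].$$ Let $(\sigma_t)$ be a continuous process in $L^2_{\mathcal F}(0,T;\mathbf R^d)$. Suppose that (i) $\theta_t\ge\theta'_t$ for each $t\in[t_0-l,t_0]$; (ii) for each $t\in[0,T]$ and $\mathbf x\in\overline L^2_{\mathcal F}(t_0-l,T+u)$, $b(t,\mathbf x)\ge b'(t,\mathbf x)$; and for each $t\in[0,T]$ and $\mathbf x,\mathbf x'\in\overline L^2_{\mathcal F}(t_0-l,T+u)$, $b'(t,\mathbf x)\ge b'(t,\mathbf x')$ whenever $x_r\ge x'_r$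 for each $r\in[t_0,T]$. Let the SDE with coefficients $(b,\sigma)$ and initial data $\theta$ and the SDE with coefficients $(b',\sigma)$ and initial data $\theta'$ have unique solutions $\mathbf X$ and $\mathbf X'$, respectively. Then, for a sufficiently small $u$ or a sufficiently small $K_2$ (that is: given $K_2$, provided $u$ is below some positive threshold; or given $u$, provided $K_2$ is below some positive threshold), $X_t\ge X'_t$ for each $t\in[t_0-l,T+u]$.
   Context: $(\Omega,\mathcal F,P)$ is a complete probability space with a $d$-dimensional standard Brownian motion $(B_t)_{t\ge0}$; $(\mathcal F_t)_{t\ge0}$ is its natural filtration augmented by the $P$-null sets. $T>0$, $l\ge0$, $u\ge0$ and $t_0\in[0,T]$ are given constants. $|\cdot|$ is the Euclidean norm. Spaces (when $d=1$, the target $\mathbf R^d$ is omitted from the notation): - $L^2(\mathcal F_t;\mathbf R^d)$: $\mathcal F_t$-measurable $\mathbf R^d$-valued random variables $\xi$ with $E|\xi|^2<\infty$. - $L^2_{\mathcal F}(a,b;\mathbf R^d)$ ($0\le a\le b$): $\mathbf R^d$-valued progressively measurable processes $\psi$ on $[a,b]$ with $E\int_a^b|\psi_r|^2dr<\infty$. - $\mathcal S^2_{\mathcal F}(a,b;\mathbf R^d)$: continuous processes in $L^2_{\mathcal F}(a,b;\mathbf R^d)$ with $E[\sup_{r\in[a,b]}|\psi_r|^2]<\infty$. - $\overline L^2_{\mathcal F}(a,b;\mathbf R^d)$ ($a\le b$, $b\ge0$, $a$ possibly negative): processes $\psi$ on $[a,b]$ whose restriction to $[a,b]\cap[0,\infty)$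 is progressively measurable and square integrable with respect to $dP\times dr$, and whose restriction to $[a,b]\cap(-\infty,0]$ (if $a<0$) is a deterministic Lebesgue square integrable function. Boldface $\mathbf X$ denotes the whole process $\{X_t\}_{t_0-l\le t\le T+u}$. The SDE with coefficients $(b,\sigma)$ and initial data $\theta$ is here $$X_t=X_{t_0}+\int_{t_0}^tb(s,\mathbf X)\,ds+\int_{t_0}^t\sigma_s\,dB_s,\ t\in(t_0,T];\quad X_t=\theta_t,\ t\in[t_0-l,t_0];\quad X_t=X_T,\ t\in(T,T+u].$$ A solution is a process $\mathbf X$ satisfying it with $(X_t)_{t\in[t_0,T]}\in\mathcal S^2_{\mathcal F}(t_0,T)$. *)

theory Defs
  imports "HOL-Probability.Probability"
begin

definition brownian_motion :: "'w measure \<Rightarrow> (real \<Rightarrow> 'w \<Rightarrow> real ^ 'd) \<Rightarrow> bool" where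
  "brownian_motion M B \<longleftrightarrow>
     (\<forall>t\<ge>0. B t \<in> borel_measurable M) \<and>
     (AE w in M. B 0 w = 0) \<and>
     (AE w in M. continuous_on {0..} (\<lambda>t. B t w)) \<and>
     (\<forall>(n::nat) s. 0 \<le> s 0 \<and> (\<forall>i<n. s i \<le> s (Suc i)) \<longrightarrow>
        prob_space.indep_vars M (\<lambda>_. borel) (\<lambda>i w. B (s (Suc i)) w - B (s i) w) {..<n}) \<and>
     (\<forall>s t. 0 \<le> s \<and> s < t \<longrightarrow>
        prob_space.indep_vars M (\<lambda>_. borel) (\<lambda>i w. (B t w - B s w) $ i) UNIV \<and>
        (\<forall>i. distributed M lborel (\<lambda>w. (B t w - B s w) $ i) (\<lambda>x. ennreal (normal_density 0 (sqrt (t - s)) x))))"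

definition aug_filtration :: "'w measure \<Rightarrow> (real \<Rightarrow> 'w \<Rightarrow> real ^ 'd) \<Rightarrow> real \<Rightarrow> 'w measure" where
  "aug_filtration M B t =
     sigma (space M) ({B r -` A \<inter> space M |r A. r \<in> {0..t} \<and> A \<in> sets borel} \<union> null_sets M)"

text \<open>A process on a time interval $[a,b]$ is a function of time and outcome that is
  \<^const>\<open>extensional\<close> in time, so that functionals of a process can only depend on its values
  on $[a,b]$. Below, \<open>F\<close> is a filtration indexed by $[0,\infty)$. Equalities and inequalities
  between random variables are almost sure, separately for each time, and a continuous process is
  one with almost all paths continuous.\<close>

definition prog_measurable ::
    "(real \<Rightarrow> 'w measure) \<Rightarrow> real \<Rightarrow> real \<Rightarrow> (real \<Rightarrow> 'w \<Rightarrow> 'e::topological_space) \<Rightarrow> bool" where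
  "prog_measurable F a b \<psi> \<longleftrightarrow>
     (\<forall>t\<in>{a..b}. (\<lambda>(r, w). \<psi> r w) \<in> borel_measurable (restrict_space borel {a..t} \<Otimes>\<^sub>M F t))"

definition L2_rv :: "'w measure \<Rightarrow> 'w measure \<Rightarrow> ('w \<Rightarrow> 'e::real_normed_vector) set" where
  "L2_rv M G = {\<xi>. \<xi> \<in> borel_measurable G \<and> (\<integral>\<^sup>+w. ennreal ((norm (\<xi> w))\<^sup>2) \<partial>M) < \<infinity>}"

definition L2_proc :: "'w measure \<Rightarrow> (real \<Rightarrow> 'w measure) \<Rightarrow> real \<Rightarrow> real \<Rightarrow>
    (real \<Rightarrow> 'w \<Rightarrow> 'e::real_normed_vector) set" where
  "L2_proc M F a b = {\<psi> \<in> extensional {a..b}. prog_measurable F a b \<psi> \<and>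
     (\<integral>\<^sup>+w. (\<integral>\<^sup>+r\<in>{a..b}. ennreal ((norm (\<psi> r w))\<^sup>2) \<partial>lborel) \<partial>M) < \<infinity>}"

definition continuous_proc ::
    "'w measure \<Rightarrow> real \<Rightarrow> real \<Rightarrow> (real \<Rightarrow> 'w \<Rightarrow> 'e::topological_space) \<Rightarrow> bool" where
  "continuous_proc M a b \<psi> \<longleftrightarrow> (AE w in M. continuous_on {a..b} (\<lambda>t. \<psi> t w))"

definition S2_proc :: "'w measure \<Rightarrow> (real \<Rightarrow> 'w measure) \<Rightarrow> real \<Rightarrow> real \<Rightarrow>
    (real \<Rightarrow> 'w \<Rightarrow> 'e::real_normed_vector) set" where
  "S2_proc M F a b = {\<psi> \<in> L2_proc M F a b. continuous_proc M a b \<psi> \<and>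
     (\<integral>\<^sup>+w. (SUP r\<in>{a..b}. ennreal ((norm (\<psi> r w))\<^sup>2)) \<partial>M) < \<infinity>}"

text \<open>The space written $\overline L^2_{\mathcal F}(a,b)$, for $a \le b$, $b \ge 0$ and $a$ possibly
  negative. The deterministic part is represented by a Borel (not merely Lebesgue) measurable
  function, because it is integrated against arbitrary Borel measures in \<open>cond_lipschitz\<close>.\<close>

definition L2bar :: "'w measure \<Rightarrow> (real \<Rightarrow> 'w measure) \<Rightarrow> real \<Rightarrow> real \<Rightarrow>
    (real \<Rightarrow> 'w \<Rightarrow> real) set" where
  "L2bar M F a b = {\<psi> \<in> extensional {a..b}.
     restrict \<psi> {max a 0..b} \<in> L2_proc M F (max a 0) b \<and>
     (a < 0 \<longrightarrow> (\<exists>f \<in> borel_measurable borel.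
        set_integrable lborel ({a..b} \<inter> {..0}) (\<lambda>t. (f t)\<^sup>2) \<and>
        (\<forall>t \<in> {a..b} \<inter> {..0}. \<forall>w \<in> space M. \<psi> t w = f t)))}"

text \<open>The integrand $\sum_{i<n} \xi_i 1_{(s_i,s_{i+1}]}$ on $[a,b]$, with each $\xi_i$ bounded and
  $\mathcal F_{s_i}$-measurable, and its stochastic integral.\<close>

definition simple_integrand :: "'w measure \<Rightarrow> (real \<Rightarrow> 'w measure) \<Rightarrow> real \<Rightarrow> real \<Rightarrow>
    nat \<Rightarrow> (nat \<Rightarrow> real) \<Rightarrow> (nat \<Rightarrow> 'w \<Rightarrow> real ^ 'd) \<Rightarrow> bool" where
  "simple_integrand M F a b n s \<xi> \<longleftrightarrow>
     s 0 = a \<and> s n = b \<and> (\<forall>i<n. s i < s (Suc i)) \<and>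
     (\<forall>i<n. \<xi> i \<in> borel_measurable (F (s i)) \<and> (\<exists>C. \<forall>w \<in> space M. norm (\<xi> i w) \<le> C))"

definition simple_proc ::
    "nat \<Rightarrow> (nat \<Rightarrow> real) \<Rightarrow> (nat \<Rightarrow> 'w \<Rightarrow> real ^ 'd) \<Rightarrow> real \<Rightarrow> 'w \<Rightarrow> real ^ 'd" where
  "simple_proc n s \<xi> r w = (\<Sum>i<n. indicator {s i<..s (Suc i)} r *\<^sub>R \<xi> i w)"

definition simple_integral :: "(real \<Rightarrow> 'w \<Rightarrow> real ^ 'd) \<Rightarrow>
    nat \<Rightarrow> (nat \<Rightarrow> real) \<Rightarrow> (nat \<Rightarrow> 'w \<Rightarrow> real ^ 'd) \<Rightarrow> 'w \<Rightarrow> real" where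
  "simple_integral B n s \<xi> w = (\<Sum>i<n. \<xi> i w \<bullet> (B (s (Suc i)) w - B (s i) w))"

text \<open>The Ito integral over $[a,b]$ is the $L^2(P)$-limit of the integrals of simple processes that
  approximate the integrand in $L^2(dP \times dr)$; it is determined up to almost sure equality, and
  \<open>ito_integral\<close> picks a version.\<close>

definition is_ito_integral :: "'w measure \<Rightarrow> (real \<Rightarrow> 'w measure) \<Rightarrow> (real \<Rightarrow> 'w \<Rightarrow> real ^ 'd) \<Rightarrow>
    (real \<Rightarrow> 'w \<Rightarrow> real ^ 'd) \<Rightarrow> real \<Rightarrow> real \<Rightarrow> ('w \<Rightarrow> real) \<Rightarrow> bool" where
  "is_ito_integral M F B \<sigma> a b I \<longleftrightarrow> I \<in> L2_rv M (F b) \<and>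
     (\<exists>n s \<xi>. (\<forall>k::nat. simple_integrand M F a b (n k) (s k) (\<xi> k)) \<and>
        (\<lambda>k. \<integral>\<^sup>+w. (\<integral>\<^sup>+r\<in>{a..b}. ennreal ((norm (\<sigma> r w - simple_proc (n k) (s k) (\<xi> k) r w))\<^sup>2)
               \<partial>lborel) \<partial>M) \<longlonglongrightarrow> 0 \<and>
        (\<lambda>k. \<integral>\<^sup>+w. ennreal ((I w - simple_integral B (n k) (s k) (\<xi> k) w)\<^sup>2) \<partial>M) \<longlonglongrightarrow> 0)"

definition ito_integral :: "'w measure \<Rightarrow> (real \<Rightarrow> 'w measure) \<Rightarrow> (real \<Rightarrow> 'w \<Rightarrow> real ^ 'd) \<Rightarrow>
    (real \<Rightarrow> 'w \<Rightarrow> real ^ 'd) \<Rightarrow> real \<Rightarrow> real \<Rightarrow> 'w \<Rightarrow> real" where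
  "ito_integral M F B \<sigma> a b = (SOME I. is_ito_integral M F B \<sigma> a b I)"

text \<open>A drift \<open>h\<close> takes the outcome, the time and a whole process; it is admissible if it maps each
  process in \<open>L2bar\<close> to a continuous process in \<open>L2_proc\<close> on $[0,T]$.\<close>

type_synonym 'w drift = "'w \<Rightarrow> real \<Rightarrow> (real \<Rightarrow> 'w \<Rightarrow> real) \<Rightarrow> real"

definition admissible_drift :: "'w measure \<Rightarrow> (real \<Rightarrow> 'w measure) \<Rightarrow> real \<Rightarrow> real \<Rightarrow> real \<Rightarrow> real \<Rightarrow>
    'w drift \<Rightarrow> bool" where
  "admissible_drift M F T l u t0 h \<longleftrightarrow>
     (\<forall>x \<in> L2bar M F (t0 - l) (T + u).
        (\<lambda>t\<in>{0..T}. \<lambda>w. h w t x) \<in> L2_proc M F 0 T \<and>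
        continuous_proc M 0 T (\<lambda>t w. h w t x))"

text \<open>The conditional expectation is that of a nonnegative random variable, possibly infinite.\<close>

definition cond_lipschitz :: "'w measure \<Rightarrow> (real \<Rightarrow> 'w measure) \<Rightarrow> real \<Rightarrow> real \<Rightarrow> real \<Rightarrow> real \<Rightarrow>
    real \<Rightarrow> 'w drift \<Rightarrow> bool" where
  "cond_lipschitz M F T l u t0 K h \<longleftrightarrow>
     (\<exists>\<mu>. prob_space \<mu> \<and> sets \<mu> = sets (restrict_space borel {-l..u}) \<and>
        (\<forall>t\<in>{t0..T}. \<forall>x \<in> L2bar M F (t0 - l) (T + u). \<forall>y \<in> L2bar M F (t0 - l) (T + u).
           AE w in M. ennreal \<bar>h w t x - h w t y\<bar> \<le>
             ennreal K * nn_cond_exp M (F t)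
               (\<lambda>w. \<integral>\<^sup>+r. ennreal \<bar>x (t + r) w - y (t + r) w\<bar> \<partial>\<mu>) w))"

definition sde_solution :: "'w measure \<Rightarrow> (real \<Rightarrow> 'w measure) \<Rightarrow> (real \<Rightarrow> 'w \<Rightarrow> real ^ 'd) \<Rightarrow>
    real \<Rightarrow> real \<Rightarrow> real \<Rightarrow> real \<Rightarrow> 'w drift \<Rightarrow> (real \<Rightarrow> 'w \<Rightarrow> real ^ 'd) \<Rightarrow> (real \<Rightarrow> 'w \<Rightarrow> real) \<Rightarrow>
    (real \<Rightarrow> 'w \<Rightarrow> real) \<Rightarrow> bool" where
  "sde_solution M F B T l u t0 b \<sigma> \<theta> X \<longleftrightarrow>
     X \<in> L2bar M F (t0 - l) (T + u) \<and>
     restrict X {t0..T} \<in> S2_proc M F t0 T \<and>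
     (\<forall>t\<in>{t0<..T}. AE w in M.
        X t w = X t0 w + (LINT s:{t0..t}|lborel. b w s X) + ito_integral M F B \<sigma> t0 t w) \<and>
     (\<forall>t\<in>{t0-l..t0}. AE w in M. X t w = \<theta> t w) \<and>
     (\<forall>t\<in>{T<..T+u}. AE w in M. X t w = X T w)"

definition unique_sde_solution :: "'w measure \<Rightarrow> (real \<Rightarrow> 'w measure) \<Rightarrow>
    (real \<Rightarrow> 'w \<Rightarrow> real ^ 'd) \<Rightarrow> real \<Rightarrow> real \<Rightarrow> real \<Rightarrow> real \<Rightarrow> 'w drift \<Rightarrow>
    (real \<Rightarrow> 'w \<Rightarrow> real ^ 'd) \<Rightarrow> (real \<Rightarrow> 'w \<Rightarrow> real) \<Rightarrow> (real \<Rightarrow> 'w \<Rightarrow> real) \<Rightarrow> bool" where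
  "unique_sde_solution M F B T l u t0 b \<sigma> \<theta> X \<longleftrightarrow>
     sde_solution M F B T l u t0 b \<sigma> \<theta> X \<and>
     (\<forall>Y. sde_solution M F B T l u t0 b \<sigma> \<theta> Y \<longrightarrow>
        (\<forall>t\<in>{t0-l..T+u}. AE w in M. Y t w = X t w))"

text \<open>The hypotheses of the comparison theorem for given \<open>u\<close> and Lipschitz constant \<open>K2\<close>. A common
  constant for \<open>b\<close> and \<open>b'\<close> is no restriction (take the maximum); the two measures may differ.\<close>

definition comparison_hyps :: "'w measure \<Rightarrow> (real \<Rightarrow> 'w measure) \<Rightarrow> (real \<Rightarrow> 'w \<Rightarrow> real ^ 'd) \<Rightarrow>
    real \<Rightarrow> real \<Rightarrow> real \<Rightarrow> real \<Rightarrow> real \<Rightarrow> (real \<Rightarrow> 'w \<Rightarrow> real) \<Rightarrow> (real \<Rightarrow> 'w \<Rightarrow> real) \<Rightarrow>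
    'w drift \<Rightarrow> 'w drift \<Rightarrow> (real \<Rightarrow> 'w \<Rightarrow> real ^ 'd) \<Rightarrow> (real \<Rightarrow> 'w \<Rightarrow> real) \<Rightarrow>
    (real \<Rightarrow> 'w \<Rightarrow> real) \<Rightarrow> bool" where
  "comparison_hyps M F B T l u t0 K2 \<theta> \<theta>' b b' \<sigma> X X' \<longleftrightarrow>
     \<theta> \<in> L2bar M F (t0 - l) t0 \<and> \<theta>' \<in> L2bar M F (t0 - l) t0 \<and>
     \<theta> t0 \<in> L2_rv M (F t0) \<and> \<theta>' t0 \<in> L2_rv M (F t0) \<and>
     admissible_drift M F T l u t0 b \<and> admissible_drift M F T l u t0 b' \<and>
     cond_lipschitz M F T l u t0 K2 b \<and> cond_lipschitz M F T l u t0 K2 b' \<and>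
     \<sigma> \<in> L2_proc M F 0 T \<and> continuous_proc M 0 T \<sigma> \<and>
     (\<forall>t\<in>{t0-l..t0}. AE w in M. \<theta> t w \<ge> \<theta>' t w) \<and>
     (\<forall>t\<in>{0..T}. \<forall>x \<in> L2bar M F (t0 - l) (T + u). AE w in M. b w t x \<ge> b' w t x) \<and>
     (\<forall>t\<in>{0..T}. \<forall>x \<in> L2bar M F (t0 - l) (T + u). \<forall>x' \<in> L2bar M F (t0 - l) (T + u).
        (\<forall>r\<in>{t0..T}. AE w in M. x r w \<ge> x' r w) \<longrightarrow> (AE w in M. b' w t x \<ge> b' w t x')) \<and>
     unique_sde_solution M F B T l u t0 b \<sigma> \<theta> X \<and>
     unique_sde_solution M F B T l u t0 b' \<sigma> \<theta>' X'"

end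

theory Submission
  imports Defs
begin

text \<open>
  The diffusion coefficient does not depend on the solution, so the stochastic integrals cancel in
  $X' - X$ and the comparison becomes a pathwise question about absolutely continuous processes.

  Write $\varphi(t) = E[(X'_t - X_t)^+]$ for the expected excess and $Y = X \vee X'$. Since
  $Y \ge X'$, monotonicity of $b'$ and $b' \le b$ give
  $b'(s, X') - b(s, X) \le b'(s, Y) - b'(s, X)$, and $X'_{t_0} \le X_{t_0}$, so
  $$(X'_t - X_t)^+ \le \int_{t_0}^t |b'(s, Y) - b'(s, X)|\, ds$$
  (\<open>sde_solution_excess_le\<close>). As $Y - X = (X' - X)^+$, taking expectations in the Lipschitz
  condition removes the conditioning (\<open>cond_lipschitz_expectation_bound\<close>) and yields
  $$\varphi(t) \le K \int_{t_0}^t \int_{-l}^u \varphi(s + r)\, \lambda(dr)\, ds .$$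
  The inner integral looks up to $u$ into the future, so Gronwall's inequality does not apply.
  Instead one works with the weight $e^{ct}$: if $\varphi(t) \le N e^{ct}$ on the whole interval, then
  $\varphi(t) \le q N e^{ct}$ with $q = K e^{cu} / c$ (\<open>excess_contraction\<close>). The function
  $\varphi$ is bounded (\<open>excess_bounded\<close>), so if $q < 1$ iteration gives $\varphi = 0$
  (\<open>comparison_if_contraction\<close>). Some $c > 0$ with $K e^{cu} < c$ exists whenever $u$ is small
  compared with $1/K$: for given $K$ take $c = 2K$ and $u < \ln 2 / (2K)$, for given $u$ take $c = 1$
  and $K < e^{-u}$.
\<close>

section \<open>Measurability and closure under maxima\<close>

lemma aug_filtration_subalgebra:
  assumes "brownian_motion M B"
  shows "subalgebra M (aug_filtration M B t)"
proof -
  have "{B r -` A \<inter> space M |r A. r \<in> {0..t} \<and> A \<in> sets borel} \<union> null_sets M \<subseteq> sets M"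
    using assms unfolding brownian_motion_def by (auto intro: measurable_sets)
  from this subset_trans[OF this sets.space_closed] show ?thesis
    unfolding subalgebra_def aug_filtration_def
    by (simp only: sets_measure_of space_measure_of sets.sigma_sets_subset simp_thms)
qed

lemma borel_measurable_pair_subalgebra:
  assumes "subalgebra M G" "f \<in> borel_measurable (A \<Otimes>\<^sub>M G)"
  shows "f \<in> borel_measurable (A \<Otimes>\<^sub>M M)"
proof -
  have "(\<lambda>p. (fst p, snd p)) \<in> (A \<Otimes>\<^sub>M M) \<rightarrow>\<^sub>M (A \<Otimes>\<^sub>M G)"
    by (intro measurable_Pair measurable_fst measurable_compose[OF measurable_snd]
        measurable_from_subalg[OF assms(1)] measurable_ident_sets[OF refl])
  from measurable_compose[OF this assms(2)] show ?thesis by simp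
qed

lemma L2_proc_jointly_measurable:
  assumes "subalgebra M (F b)" "a \<le> b" "\<psi> \<in> L2_proc M F a b"
  shows "(\<lambda>(r, w). \<psi> r w) \<in> borel_measurable (restrict_space borel {a..b} \<Otimes>\<^sub>M M)"
  using assms by (auto simp: L2_proc_def prog_measurable_def
      intro!: borel_measurable_pair_subalgebra[OF assms(1)])

text \<open>Progressive measurability at the right end point gives joint measurability on the
  nonnegative times, and before time zero the process is a Borel function of time alone. The two
  descriptions are glued along \<open>r = 0\<close>.\<close>

lemma L2bar_jointly_measurable:
  assumes "subalgebra M (F b)" "a \<le> b" "0 \<le> b" "x \<in> L2bar M F a b"
  shows "(\<lambda>(r, w). x r w) \<in> borel_measurable (restrict_space borel {a..b} \<Otimes>\<^sub>M M)"
proof -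
  have pos: "(\<lambda>(r, w). restrict x {max a 0..b} r w)
      \<in> borel_measurable (restrict_space borel {max a 0..b} \<Otimes>\<^sub>M M)"
  proof (rule L2_proc_jointly_measurable[where F=F, OF assms(1)])
    show "restrict x {max a 0..b} \<in> L2_proc M F (max a 0) b"
      using assms(4) unfolding L2bar_def by blast
  qed (use assms in simp)
  show ?thesis
  proof (cases "a < 0")
    case False
    have "(\<lambda>(r, w). x r w) \<in> borel_measurable (restrict_space borel {a..b} \<Otimes>\<^sub>M M) \<longleftrightarrow>
      (\<lambda>(r, w). restrict x {max a 0..b} r w)
      \<in> borel_measurable (restrict_space borel {a..b} \<Otimes>\<^sub>M M)"
      using False by (intro measurable_cong) (auto simp: space_pair_measure)
    then show ?thesis using pos False by (simp add: max_absorb1)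
  next
    case True
    then obtain f where [measurable]: "f \<in> borel_measurable borel"
      and f: "\<And>t w. t \<in> {a..b} \<inter> {..0} \<Longrightarrow> w \<in> space M \<Longrightarrow> x t w = f t"
      using assms unfolding L2bar_def by blast
    \<comment> \<open>Clamping the time at zero makes the nonnegative part measurable on the whole interval, so that
      an if-expression can join the two parts.\<close>
    have "(\<lambda>p. (max (fst p) 0, snd p))
        \<in> (restrict_space borel {a..b} \<Otimes>\<^sub>M M) \<rightarrow>\<^sub>M (restrict_space borel {max a 0..b} \<Otimes>\<^sub>M M)"
      using assms(3) True
      by (intro measurable_Pair measurable_snd measurable_restrict_space2
          borel_measurable_max measurable_const
          measurable_compose[OF measurable_fst] measurable_restrict_space1 measurable_ident)
        (auto simp: space_pair_measure)
    from measurable_compose[OF this pos] have [measurable]: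
      "(\<lambda>p. restrict x {max a 0..b} (max (fst p) 0) (snd p))
        \<in> borel_measurable (restrict_space borel {a..b} \<Otimes>\<^sub>M M)" by simp
    have [measurable]: "fst \<in> borel_measurable (restrict_space borel {a..b} \<Otimes>\<^sub>M M)"
      by (intro measurable_compose[OF measurable_fst] measurable_restrict_space1 measurable_ident_sets refl)
    have "(\<lambda>p. if fst p \<le> 0 then f (fst p) else restrict x {max a 0..b} (max (fst p) 0) (snd p))
        \<in> borel_measurable (restrict_space borel {a..b} \<Otimes>\<^sub>M M)"
      by measurable
    then show ?thesis
      by (rule measurable_cong[THEN iffD1, rotated])
         (use f True in \<open>auto simp: space_pair_measure\<close>)
  qed
qed

lemma L2bar_measurable_at:
  assumes "subalgebra M (F b)" "a \<le> b" "0 \<le> b" "x \<in> L2bar M F a b" "t \<in> {a..b}"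
  shows "x t \<in> borel_measurable M"
  using measurable_compose[OF measurable_Pair1' L2bar_jointly_measurable[of M F b a x, OF assms(1-4)], of t]
    assms(5) by (simp add: space_restrict_space)

lemma L2_proc_max:
  fixes x y :: "real \<Rightarrow> 'w \<Rightarrow> real"
  assumes sub: "subalgebra M (F b)" and ab: "a \<le> b"
    and x: "x \<in> L2_proc M F a b" and y: "y \<in> L2_proc M F a b"
  shows "(\<lambda>r w. max (x r w) (y r w)) \<in> L2_proc M F a b"
proof -
  let ?P = "restrict_space borel {a..b} \<Otimes>\<^sub>M M"
  have prog: "prog_measurable F a b (\<lambda>r w. max (x r w) (y r w))"
    using x y unfolding L2_proc_def prog_measurable_def
    by (auto simp: split_beta' intro!: borel_measurable_max)
  have L2: "(\<integral>\<^sup>+w. (\<integral>\<^sup>+r\<in>{a..b}. ennreal ((norm (z r w))\<^sup>2) \<partial>lborel) \<partial>M) =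
      (\<integral>\<^sup>+w. (\<integral>\<^sup>+r. ennreal ((z r w)\<^sup>2) \<partial>restrict_space lborel {a..b}) \<partial>M)"
    for z :: "real \<Rightarrow> 'w \<Rightarrow> real"
    by (simp add: nn_integral_restrict_space)
  interpret R: sigma_finite_measure "restrict_space lborel {a..b}"
    by (rule sigma_finite_measure_restrict_space) (auto simp: sigma_finite_lborel)
  have sets: "sets (restrict_space lborel {a..b}) = sets (restrict_space borel {a..b})"
    by (intro sets_restrict_space_cong) simp
  have [measurable]: "(\<lambda>p. x (fst p) (snd p)) \<in> borel_measurable (restrict_space lborel {a..b} \<Otimes>\<^sub>M M)"
    "(\<lambda>p. y (fst p) (snd p)) \<in> borel_measurable (restrict_space lborel {a..b} \<Otimes>\<^sub>M M)"
    using L2_proc_jointly_measurable[OF sub ab x] L2_proc_jointly_measurable[OF sub ab y]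
    by (simp_all add: split_beta' measurable_cong_sets[OF sets_pair_measure_cong[OF sets refl] refl])
  have [measurable]: "(\<lambda>r. x r w) \<in> borel_measurable (restrict_space lborel {a..b})"
      "(\<lambda>r. y r w) \<in> borel_measurable (restrict_space lborel {a..b})" if "w \<in> space M" for w
    using that measurable_compose[OF measurable_Pair2'[OF that], of "\<lambda>p. x (fst p) (snd p)"]
      measurable_compose[OF measurable_Pair2'[OF that], of "\<lambda>p. y (fst p) (snd p)"] by simp_all
  have [measurable]: "(\<lambda>p. x (snd p) (fst p)) \<in> borel_measurable (M \<Otimes>\<^sub>M restrict_space lborel {a..b})"
    "(\<lambda>p. y (snd p) (fst p)) \<in> borel_measurable (M \<Otimes>\<^sub>M restrict_space lborel {a..b})"
    using measurable_compose[OF measurable_pair_swap', of "\<lambda>p. x (fst p) (snd p)"]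
      measurable_compose[OF measurable_pair_swap', of "\<lambda>p. y (fst p) (snd p)"]
    by (simp_all add: split_beta')
  have "(\<integral>\<^sup>+w. (\<integral>\<^sup>+r. ennreal ((max (x r w) (y r w))\<^sup>2) \<partial>restrict_space lborel {a..b}) \<partial>M)
    \<le> (\<integral>\<^sup>+w. (\<integral>\<^sup>+r. ennreal ((x r w)\<^sup>2) + ennreal ((y r w)\<^sup>2) \<partial>restrict_space lborel {a..b}) \<partial>M)"
    by (intro nn_integral_mono) (auto simp: max_def simp flip: ennreal_plus)
  also have "\<dots> = (\<integral>\<^sup>+w. (\<integral>\<^sup>+r. ennreal ((x r w)\<^sup>2) \<partial>restrict_space lborel {a..b}) +
      (\<integral>\<^sup>+r. ennreal ((y r w)\<^sup>2) \<partial>restrict_space lborel {a..b}) \<partial>M)"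
    by (intro nn_integral_cong nn_integral_add) auto
  also have "\<dots> = (\<integral>\<^sup>+w. (\<integral>\<^sup>+r. ennreal ((x r w)\<^sup>2) \<partial>restrict_space lborel {a..b}) \<partial>M) +
     (\<integral>\<^sup>+w. (\<integral>\<^sup>+r. ennreal ((y r w)\<^sup>2) \<partial>restrict_space lborel {a..b}) \<partial>M)"
    by (intro nn_integral_add R.borel_measurable_nn_integral) (auto simp: split_beta')
  also have "\<dots> < \<infinity>"
    using x y unfolding L2_proc_def mem_Collect_eq L2 by simp
  finally have "(\<integral>\<^sup>+w. (\<integral>\<^sup>+r\<in>{a..b}. ennreal ((norm (max (x r w) (y r w)))\<^sup>2) \<partial>lborel) \<partial>M) < \<infinity>"
    by (subst L2)
  moreover have "(\<lambda>r w. max (x r w) (y r w)) \<in> extensional {a..b}"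
    using x y by (auto simp: L2_proc_def extensional_def)
  ultimately show ?thesis
    using prog by (simp add: L2_proc_def)
qed

text \<open>The pointwise maximum of two solutions has to be an admissible argument of the drift, because
  the proof compares both solutions through it.\<close>

lemma L2bar_max:
  assumes sub: "subalgebra M (F b)" and ab: "a \<le> b" "0 \<le> b"
    and x: "x \<in> L2bar M F a b" and y: "y \<in> L2bar M F a b"
  shows "(\<lambda>r w. max (x r w) (y r w)) \<in> L2bar M F a b"
proof -
  have "(\<lambda>r w. max (restrict x {max a 0..b} r w) (restrict y {max a 0..b} r w))
      \<in> L2_proc M F (max a 0) b"
  proof (rule L2_proc_max[where F=F, OF sub])
    show "restrict x {max a 0..b} \<in> L2_proc M F (max a 0) b"
      "restrict y {max a 0..b} \<in> L2_proc M F (max a 0) b"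
      using x y unfolding L2bar_def by blast+
  qed (use ab in simp)
  \<comment> \<open>Outside the interval both sides are the default value, since \<open>max undefined undefined = undefined\<close>.\<close>
  also have "(\<lambda>r w. max (restrict x {max a 0..b} r w) (restrict y {max a 0..b} r w))
      = restrict (\<lambda>r w. max (x r w) (y r w)) {max a 0..b}"
    by (auto simp: restrict_def fun_eq_iff)
  finally have pos: "restrict (\<lambda>r w. max (x r w) (y r w)) {max a 0..b} \<in> L2_proc M F (max a 0) b" .
  have "\<exists>h\<in>borel_measurable borel. set_integrable lborel ({a..b} \<inter> {..0}) (\<lambda>t. (h t)\<^sup>2) \<and>
      (\<forall>t\<in>{a..b} \<inter> {..0}. \<forall>w\<in>space M. max (x t w) (y t w) = h t)" if a: "a < 0"
  proof -
    obtain f where f[measurable]: "f \<in> borel_measurable borel"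
      "set_integrable lborel ({a..b} \<inter> {..0}) (\<lambda>t. (f t)\<^sup>2)"
      "\<forall>t\<in>{a..b} \<inter> {..0}. \<forall>w\<in>space M. x t w = f t"
      using x a unfolding L2bar_def by blast
    obtain g where g[measurable]: "g \<in> borel_measurable borel"
      "set_integrable lborel ({a..b} \<inter> {..0}) (\<lambda>t. (g t)\<^sup>2)"
      "\<forall>t\<in>{a..b} \<inter> {..0}. \<forall>w\<in>space M. y t w = g t"
      using y a unfolding L2bar_def by blast
    have "set_integrable lborel ({a..b} \<inter> {..0}) (\<lambda>t. (max (f t) (g t))\<^sup>2)"
      unfolding set_integrable_def
      by (rule Bochner_Integration.integrable_bound[OF set_integral_add(1)[OF f(2) g(2), unfolded set_integrable_def]])
         (auto simp: indicator_def max_def)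
    then show ?thesis
      using f g by (intro bexI[of _ "\<lambda>t. max (f t) (g t)"]) auto
  qed
  then show ?thesis
    using pos x y by (auto simp: L2bar_def extensional_def)
qed

section \<open>Estimates for the drift\<close>

text \<open>The conditional expectation integrates to the unconditional one, and Tonelli's theorem moves the
  expectation inside \<open>\<mu>\<close>. The shift \<open>r\<close> is at most \<open>u\<close>, which costs the factor \<open>exp (c * u)\<close>.\<close>

lemma cond_lipschitz_expectation_bound:
  assumes M: "prob_space M" and sub: "\<And>t. subalgebra M (F t)"
    and h: "cond_lipschitz M F T l u t0 K h"
    and pos: "0 \<le> l" "0 \<le> u" "0 \<le> t0" "0 \<le> K" "0 \<le> N" "0 \<le> c"
    and x: "x \<in> L2bar M F (t0 - l) (T + u)" and y: "y \<in> L2bar M F (t0 - l) (T + u)"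
    and bound: "\<And>r. r \<in> {t0-l..T+u} \<Longrightarrow>
      (\<integral>\<^sup>+w. ennreal \<bar>x r w - y r w\<bar> \<partial>M) \<le> ennreal (N * exp (c * r))"
    and t: "t \<in> {t0..T}"
  shows "(\<integral>\<^sup>+w. ennreal \<bar>h w t x - h w t y\<bar> \<partial>M) \<le> ennreal (K * N * exp (c * (t + u)))"
proof -
  interpret prob_space M by (rule M)
  obtain \<mu> where "prob_space \<mu>" and sets: "sets \<mu> = sets (restrict_space borel {-l..u})"
    and lip: "AE w in M. ennreal \<bar>h w t x - h w t y\<bar> \<le>
             ennreal K * nn_cond_exp M (F t)
               (\<lambda>w. \<integral>\<^sup>+r. ennreal \<bar>x (t + r) w - y (t + r) w\<bar> \<partial>\<mu>) w"
    using h t x y unfolding cond_lipschitz_def by blast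
  interpret \<mu>: prob_space \<mu> by fact
  interpret P: pair_sigma_finite \<mu> M ..
  interpret S: sigma_finite_subalgebra M "F t"
    using finite_measure_subalgebra_is_sigma_finite[of M "F t"] sub[of t]
    by (simp add: finite_measure_subalgebra_def finite_measure_axioms
        finite_measure_subalgebra_axioms_def)
  have space: "space \<mu> = {-l..u}"
    using sets_eq_imp_space_eq[OF sets] by (simp add: space_restrict_space)
  have id: "(\<lambda>r. r) \<in> borel_measurable \<mu>"
    by (subst measurable_cong_sets[OF sets refl]) (auto intro: measurable_restrict_space1)
  have "(\<lambda>p. (t + fst p, snd p)) \<in> (\<mu> \<Otimes>\<^sub>M M) \<rightarrow>\<^sub>M (restrict_space borel {t0-l..T+u} \<Otimes>\<^sub>M M)"
    using t
    by (intro measurable_Pair measurable_snd measurable_restrict_space2 borel_measurable_add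
         measurable_const measurable_compose[OF measurable_fst id])
       (auto simp: space space_pair_measure)
  from measurable_compose[OF this L2bar_jointly_measurable[OF sub _ _ x]]
    measurable_compose[OF this L2bar_jointly_measurable[OF sub _ _ y]]
  have [measurable]: "(\<lambda>p. x (t + fst p) (snd p)) \<in> borel_measurable (\<mu> \<Otimes>\<^sub>M M)"
    "(\<lambda>p. y (t + fst p) (snd p)) \<in> borel_measurable (\<mu> \<Otimes>\<^sub>M M)"
    using t pos by auto
  have mp: "(\<lambda>(r, w). ennreal \<bar>x (t + r) w - y (t + r) w\<bar>) \<in> borel_measurable (\<mu> \<Otimes>\<^sub>M M)"
    by (simp add: split_beta')
  have m: "(\<lambda>w. \<integral>\<^sup>+r. ennreal \<bar>x (t + r) w - y (t + r) w\<bar> \<partial>\<mu>) \<in> borel_measurable M"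
    using measurable_pair_swap[OF mp]
    by (intro \<mu>.borel_measurable_nn_integral) (simp add: split_beta')
  have "(\<integral>\<^sup>+w. ennreal \<bar>h w t x - h w t y\<bar> \<partial>M) \<le> (\<integral>\<^sup>+w. ennreal K * nn_cond_exp M (F t)
               (\<lambda>w. \<integral>\<^sup>+r. ennreal \<bar>x (t + r) w - y (t + r) w\<bar> \<partial>\<mu>) w \<partial>M)"
    by (rule nn_integral_mono_AE[OF lip])
  also have "\<dots> = ennreal K * (\<integral>\<^sup>+w. (\<integral>\<^sup>+r. ennreal \<bar>x (t + r) w - y (t + r) w\<bar> \<partial>\<mu>) \<partial>M)"
    using S.nn_cond_exp_intg[OF _ m, of "\<lambda>_. 1"] by (simp add: nn_integral_cmult)
  also have "\<dots> = ennreal K * (\<integral>\<^sup>+r. (\<integral>\<^sup>+w. ennreal \<bar>x (t + r) w - y (t + r) w\<bar> \<partial>M) \<partial>\<mu>)"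
    using P.Fubini'[OF mp] by simp
  also have "\<dots> \<le> ennreal K * (\<integral>\<^sup>+r. ennreal (N * exp (c * (t + u))) \<partial>\<mu>)"
  proof (intro mult_left_mono nn_integral_mono)
    fix r assume "r \<in> space \<mu>"
    then have r: "-l \<le> r" "r \<le> u" by (auto simp: space)
    have "(\<integral>\<^sup>+w. ennreal \<bar>x (t + r) w - y (t + r) w\<bar> \<partial>M) \<le> ennreal (N * exp (c * (t + r)))"
      using t r by (intro bound) auto
    also have "\<dots> \<le> ennreal (N * exp (c * (t + u)))"
      using pos r by (intro ennreal_leI mult_left_mono) (auto intro!: mult_left_mono)
    finally show "(\<integral>\<^sup>+w. ennreal \<bar>x (t + r) w - y (t + r) w\<bar> \<partial>M)
        \<le> ennreal (N * exp (c * (t + u)))" .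
  qed simp
  also have "\<dots> = ennreal (K * N * exp (c * (t + u)))"
    using pos by (simp add: \<mu>.emeasure_space_1 ennreal_mult mult.assoc)
  finally show ?thesis .
qed

lemma admissible_drift_jointly_measurable:
  assumes "subalgebra M (F T)" "0 \<le> T" "admissible_drift M F T l u t0 h"
    "x \<in> L2bar M F (t0 - l) (T + u)"
  shows "(\<lambda>(s, w). h w s x) \<in> borel_measurable (restrict_space borel {0..T} \<Otimes>\<^sub>M M)"
proof -
  have "(\<lambda>(s, w). (\<lambda>t\<in>{0..T}. \<lambda>w. h w t x) s w)
      \<in> borel_measurable (restrict_space borel {0..T} \<Otimes>\<^sub>M M)"
    using assms unfolding admissible_drift_def
    by (intro L2_proc_jointly_measurable[where F=F]) blast+
  then show ?thesis
    by (rule measurable_cong[THEN iffD1, rotated]) (auto simp: space_pair_measure)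
qed

text \<open>Continuous paths are integrable on compact intervals, so the path integrals of the drift are
  genuine integrals and not the default value zero.\<close>

lemma admissible_drift_set_integrable:
  assumes "admissible_drift M F T l u t0 h" "x \<in> L2bar M F (t0 - l) (T + u)"
    "0 \<le> a" "b \<le> T"
  shows "AE w in M. set_integrable lborel {a..b} (\<lambda>s. h w s x)"
proof -
  have "AE w in M. continuous_on {0..T} (\<lambda>s. h w s x)"
    using assms by (auto simp: admissible_drift_def continuous_proc_def)
  then show ?thesis
    by eventually_elim
      (rule set_integrable_subset[OF borel_integrable_atLeastAtMost'], use assms in auto)
qed

text \<open>For each single time the inequality holds almost surely, because $b'(s, X') \le b'(s, Y)$ by
  monotonicity and $b'(s, X) \le b(s, X)$. To integrate it along a path one needs the
  quantifiers in the other order, which joint measurability permits.\<close>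

lemma drift_le_increment_AE:
  assumes M: "prob_space M" and sub: "\<And>t. subalgebra M (F t)"
    and pos: "0 \<le> t0" "t0 \<le> T" "0 \<le> u" "0 \<le> l"
    and adm: "admissible_drift M F T l u t0 b" "admissible_drift M F T l u t0 b'"
    and le: "\<And>t x. t \<in> {0..T} \<Longrightarrow> x \<in> L2bar M F (t0 - l) (T + u) \<Longrightarrow> AE w in M. b w t x \<ge> b' w t x"
    and mono: "\<And>t x x'. t \<in> {0..T} \<Longrightarrow> x \<in> L2bar M F (t0 - l) (T + u) \<Longrightarrow> x' \<in> L2bar M F (t0 - l) (T + u) \<Longrightarrow>
        (\<forall>r\<in>{t0..T}. AE w in M. x r w \<ge> x' r w) \<Longrightarrow> (AE w in M. b' w t x \<ge> b' w t x')"
    and X: "X \<in> L2bar M F (t0 - l) (T + u)" and X': "X' \<in> L2bar M F (t0 - l) (T + u)"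
  shows "AE w in M. AE s in lborel. s \<in> {0..T} \<longrightarrow>
    b' w s X' \<le> b w s X + \<bar>b' w s (\<lambda>r w. max (X r w) (X' r w)) - b' w s X\<bar>"
proof -
  interpret prob_space M by (rule M)
  let ?Y = "\<lambda>r w. max (X r w) (X' r w)"
  let ?L = "restrict_space lborel {0..T}"
  have Y: "?Y \<in> L2bar M F (t0 - l) (T + u)"
    using pos by (intro L2bar_max sub X X') auto
  interpret L: sigma_finite_measure ?L
    by (rule sigma_finite_measure_restrict_space) (auto simp: sigma_finite_lborel)
  interpret P: pair_sigma_finite ?L M ..
  have sets: "sets ?L = sets (restrict_space borel {0..T})"
    by (intro sets_restrict_space_cong) simp
  have jm: "(\<lambda>p. h (snd p) (fst p) x) \<in> borel_measurable (?L \<Otimes>\<^sub>M M)"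
    if "admissible_drift M F T l u t0 h" "x \<in> L2bar M F (t0 - l) (T + u)" for h x
    using admissible_drift_jointly_measurable[OF sub _ that] pos
    by (simp add: split_beta' measurable_cong_sets[OF sets_pair_measure_cong[OF sets refl] refl])
  note [measurable] = jm[OF adm(1) X] jm[OF adm(2) X] jm[OF adm(2) X'] jm[OF adm(2) Y]
  let ?Q = "\<lambda>s w. b' w s X' \<le> b w s X + \<bar>b' w s ?Y - b' w s X\<bar>"
  have "AE w in M. ?Q s w" if s: "s \<in> {0..T}" for s
    using le[OF s X] mono[OF s Y X'] by (auto elim!: eventually_elim2)
  then have "AE s in ?L. AE w in M. ?Q s w"
    by (subst AE_restrict_space_iff) auto
  also have "(AE s in ?L. AE w in M. ?Q s w) \<longleftrightarrow> (AE w in M. AE s in ?L. ?Q s w)"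
    by (rule P.AE_commute) measurable
  finally show ?thesis
    by (simp add: AE_restrict_space_iff)
qed

section \<open>The expected excess of the lower solution\<close>

text \<open>Both solutions contain the same random variable \<open>ito_integral M F B \<sigma> t0 t\<close>, which cancels, and
  the difference of the drifts is bounded by the integrand on the right. The coercion \<open>ennreal\<close> sends
  negative numbers to zero, so the left-hand side is the positive part of the difference; the
  right-hand side is nonnegative, hence bounds it as well.\<close>

lemma sde_solution_excess_le:
  assumes M: "prob_space M" and sub: "\<And>t. subalgebra M (F t)"
    and pos: "0 \<le> t0" "t0 \<le> T" "0 \<le> u" "0 \<le> l"
    and hyps: "comparison_hyps M F B T l u t0 K \<theta> \<theta>' b b' \<sigma> X X'"
    and t: "t \<in> {t0..T}"
  shows "AE w in M. ennreal (X' t w - X t w) \<le>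
    (\<integral>\<^sup>+s\<in>{t0..t}. ennreal \<bar>b' w s (\<lambda>r w. max (X r w) (X' r w)) - b' w s X\<bar> \<partial>lborel)"
proof -
  let ?Y = "\<lambda>r w. max (X r w) (X' r w)"
  let ?G = "\<lambda>w s. \<bar>b' w s ?Y - b' w s X\<bar>"
  have adm: "admissible_drift M F T l u t0 b" "admissible_drift M F T l u t0 b'"
    and le: "\<And>t x. t \<in> {0..T} \<Longrightarrow> x \<in> L2bar M F (t0 - l) (T + u) \<Longrightarrow> AE w in M. b w t x \<ge> b' w t x"
    and mono: "\<And>t x x'. t \<in> {0..T} \<Longrightarrow> x \<in> L2bar M F (t0 - l) (T + u) \<Longrightarrow>
        x' \<in> L2bar M F (t0 - l) (T + u) \<Longrightarrow>
        (\<forall>r\<in>{t0..T}. AE w in M. x r w \<ge> x' r w) \<Longrightarrow> (AE w in M. b' w t x \<ge> b' w t x')"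
    and \<theta>: "\<And>t. t \<in> {t0-l..t0} \<Longrightarrow> AE w in M. \<theta> t w \<ge> \<theta>' t w"
    and solX: "sde_solution M F B T l u t0 b \<sigma> \<theta> X"
    and solX': "sde_solution M F B T l u t0 b' \<sigma> \<theta>' X'"
    using hyps unfolding comparison_hyps_def unique_sde_solution_def by blast+
  have X: "X \<in> L2bar M F (t0 - l) (T + u)" and X': "X' \<in> L2bar M F (t0 - l) (T + u)"
    using solX solX' by (auto simp: sde_solution_def)
  have Y: "?Y \<in> L2bar M F (t0 - l) (T + u)"
    using pos by (intro L2bar_max sub X X') auto
  have "AE w in M. X t0 w = \<theta> t0 w" "AE w in M. X' t0 w = \<theta>' t0 w"
    using solX solX' pos by (auto simp: sde_solution_def)
  moreover have "AE w in M. \<theta> t0 w \<ge> \<theta>' t0 w" using \<theta> pos by auto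
  ultimately have start: "AE w in M. X' t0 w \<le> X t0 w"
    by eventually_elim simp
  show ?thesis
  proof (cases "t = t0")
    case True
    then show ?thesis using start by (auto elim!: eventually_mono simp: ennreal_neg)
  next
    case False
    then have t': "t \<in> {t0<..T}" and tT: "t \<le> T" using t by auto
    have "AE w in M. X t w = X t0 w + (LINT s:{t0..t}|lborel. b w s X) + ito_integral M F B \<sigma> t0 t w"
      "AE w in M. X' t w = X' t0 w + (LINT s:{t0..t}|lborel. b' w s X') + ito_integral M F B \<sigma> t0 t w"
      using solX solX' t' by (auto simp: sde_solution_def)
    moreover have "AE w in M. AE s in lborel. s \<in> {0..T} \<longrightarrow> b' w s X' \<le> b w s X + ?G w s"
      by (rule drift_le_increment_AE[OF M sub pos adm _ _ X X']) (rule le mono; assumption)+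
    moreover note start admissible_drift_set_integrable[OF adm(1) X pos(1) tT]
      admissible_drift_set_integrable[OF adm(2) X pos(1) tT]
      admissible_drift_set_integrable[OF adm(2) X' pos(1) tT]
      admissible_drift_set_integrable[OF adm(2) Y pos(1) tT]
    ultimately show ?thesis
    proof eventually_elim
      case (elim w)
      have i: "set_integrable lborel {t0..t} (\<lambda>s. b w s X)"
        "set_integrable lborel {t0..t} (\<lambda>s. b' w s X)"
        "set_integrable lborel {t0..t} (\<lambda>s. b' w s X')"
        "set_integrable lborel {t0..t} (\<lambda>s. b' w s ?Y)"
        using elim t pos by auto
      have iG: "set_integrable lborel {t0..t} (?G w)"
        by (intro set_integrable_abs set_integral_diff i)
      have "(LINT s:{t0..t}|lborel. b' w s X') \<le> (LINT s:{t0..t}|lborel. b w s X + ?G w s)"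
        using elim(3) pos t
        by (intro set_integral_mono_AE i set_integral_add iG) (auto elim!: eventually_mono)
      also have "\<dots> = (LINT s:{t0..t}|lborel. b w s X) + (LINT s:{t0..t}|lborel. ?G w s)"
        by (intro set_integral_add i iG)
      finally have "X' t w - X t w \<le> (LINT s:{t0..t}|lborel. ?G w s)"
        using elim by simp
      then have "ennreal (X' t w - X t w) \<le> ennreal (LINT s:{t0..t}|lborel. ?G w s)"
        by (rule ennreal_leI)
      also have "\<dots> = (\<integral>\<^sup>+s. ennreal (indicator {t0..t} s *\<^sub>R ?G w s) \<partial>lborel)"
        using iG unfolding set_lebesgue_integral_def set_integrable_def
        by (intro nn_integral_eq_integral[symmetric]) auto
      also have "\<dots> = (\<integral>\<^sup>+s\<in>{t0..t}. ennreal (?G w s) \<partial>lborel)"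
        by (intro nn_integral_cong) (simp split: split_indicator)
      finally show ?case .
    qed
  qed
qed

text \<open>Before \<open>t0\<close> the expected excess vanishes by the ordering of the initial data, and after \<open>T\<close> it is
  constant. A nondecreasing bound therefore only has to be checked between \<open>t0\<close> and \<open>T\<close>, where the
  equation holds.\<close>

lemma excess_bound_extend:
  fixes g :: "real \<Rightarrow> ennreal"
  assumes pos: "t0 \<le> T" "0 \<le> u"
    and hyps: "comparison_hyps M F B T l u t0 K \<theta> \<theta>' b b' \<sigma> X X'"
    and g: "mono g"
    and bound: "\<And>t. t \<in> {t0..T} \<Longrightarrow> (\<integral>\<^sup>+w. ennreal (X' t w - X t w) \<partial>M) \<le> g t"
    and t: "t \<in> {t0-l..T+u}"
  shows "(\<integral>\<^sup>+w. ennreal (X' t w - X t w) \<partial>M) \<le> g t"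
proof -
  have \<theta>: "\<And>t. t \<in> {t0-l..t0} \<Longrightarrow> AE w in M. \<theta> t w \<ge> \<theta>' t w"
    and solX: "sde_solution M F B T l u t0 b \<sigma> \<theta> X"
    and solX': "sde_solution M F B T l u t0 b' \<sigma> \<theta>' X'"
    using hyps unfolding comparison_hyps_def unique_sde_solution_def by blast+
  consider "t \<in> {t0-l..t0}" | "t \<in> {t0..T}" | "t \<in> {T<..T+u}" using t by fastforce
  then show ?thesis
  proof cases
    case 1
    then have "AE w in M. X t w = \<theta> t w" "AE w in M. X' t w = \<theta>' t w"
      using solX solX' by (auto simp: sde_solution_def)
    then have "AE w in M. ennreal (X' t w - X t w) = 0"
      using \<theta>[OF 1] by eventually_elim (simp add: ennreal_neg)
    then have "(\<integral>\<^sup>+w. ennreal (X' t w - X t w) \<partial>M) = (\<integral>\<^sup>+w. 0 \<partial>M)"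
      by (rule nn_integral_cong_AE)
    then show ?thesis by simp
  next
    case 2
    then show ?thesis by (rule bound)
  next
    case 3
    then have "AE w in M. X t w = X T w" "AE w in M. X' t w = X' T w"
      using solX solX' by (auto simp: sde_solution_def)
    then have "AE w in M. ennreal (X' t w - X t w) = ennreal (X' T w - X T w)"
      by eventually_elim simp
    then have "(\<integral>\<^sup>+w. ennreal (X' t w - X t w) \<partial>M) = (\<integral>\<^sup>+w. ennreal (X' T w - X T w) \<partial>M)"
      by (rule nn_integral_cong_AE)
    also have "\<dots> \<le> g T"
      using pos by (intro bound) auto
    also have "\<dots> \<le> g t"
      using 3 by (intro monoD[OF g]) auto
    finally show ?thesis .
  qed
qed

text \<open>The factor is the result of integrating the weighted bound: \<open>exp (c * (s + u))\<close> has the primitive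
  \<open>exp (c * (s + u)) / c\<close>. The bound is assumed up to time \<open>T + u\<close>, as the drift anticipates.\<close>

lemma excess_contraction:
  assumes M: "prob_space M" and sub: "\<And>t. subalgebra M (F t)"
    and pos: "0 \<le> t0" "t0 \<le> T" "0 \<le> u" "0 \<le> l" "0 \<le> K" "0 \<le> N" "0 < c"
    and hyps: "comparison_hyps M F B T l u t0 K \<theta> \<theta>' b b' \<sigma> X X'"
    and bound: "\<And>r. r \<in> {t0-l..T+u} \<Longrightarrow>
      (\<integral>\<^sup>+w. ennreal (X' r w - X r w) \<partial>M) \<le> ennreal (N * exp (c * r))"
    and t: "t \<in> {t0-l..T+u}"
  shows "(\<integral>\<^sup>+w. ennreal (X' t w - X t w) \<partial>M) \<le> ennreal (K * exp (c * u) / c * N * exp (c * t))"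
proof -
  interpret prob_space M by (rule M)
  let ?Y = "\<lambda>r w. max (X r w) (X' r w)"
  let ?G = "\<lambda>w s. \<bar>b' w s ?Y - b' w s X\<bar>"
  let ?q = "K * exp (c * u) / c"
  have adm: "admissible_drift M F T l u t0 b'"
    and lip: "cond_lipschitz M F T l u t0 K b'"
    and X: "X \<in> L2bar M F (t0 - l) (T + u)" and X': "X' \<in> L2bar M F (t0 - l) (T + u)"
    using hyps unfolding comparison_hyps_def unique_sde_solution_def sde_solution_def by blast+
  have Y: "?Y \<in> L2bar M F (t0 - l) (T + u)"
    using pos by (intro L2bar_max sub X X') auto
  have drift: "(\<integral>\<^sup>+w. ennreal (?G w s) \<partial>M) \<le> ennreal (K * N * exp (c * (s + u)))"
    if "s \<in> {t0..T}" for s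
  proof (rule cond_lipschitz_expectation_bound[OF M sub lip _ _ _ _ _ _ Y X _ that])
    fix r assume "r \<in> {t0-l..T+u}"
    \<comment> \<open>The distance from \<open>X\<close> to the maximum is exactly the excess, so the Lipschitz condition
      reproduces the quantity that is being estimated.\<close>
    moreover have "ennreal \<bar>?Y r w - X r w\<bar> = ennreal (X' r w - X r w)" for w
      by (auto simp: max_def ennreal_neg)
    ultimately show "(\<integral>\<^sup>+w. ennreal \<bar>?Y r w - X r w\<bar> \<partial>M) \<le> ennreal (N * exp (c * r))"
      using bound by simp
  qed (use pos in auto)
  have mid: "(\<integral>\<^sup>+w. ennreal (X' t w - X t w) \<partial>M) \<le> ennreal (?q * N * exp (c * t))"
    if t: "t \<in> {t0..T}" for t
  proof -
    let ?L = "restrict_space lborel {t0..t}"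
    interpret L: sigma_finite_measure ?L
      by (rule sigma_finite_measure_restrict_space) (auto simp: sigma_finite_lborel)
    interpret P: pair_sigma_finite ?L M ..
    have sets: "sets ?L = sets (restrict_space borel {t0..t})"
      by (intro sets_restrict_space_cong) simp
    have id: "(\<lambda>r. r) \<in> borel_measurable ?L"
      by (subst measurable_cong_sets[OF sets refl]) (auto intro: measurable_restrict_space1)
    have "(\<lambda>p. (fst p, snd p)) \<in> (?L \<Otimes>\<^sub>M M) \<rightarrow>\<^sub>M (restrict_space borel {0..T} \<Otimes>\<^sub>M M)"
      using t pos
      by (intro measurable_Pair measurable_snd measurable_restrict_space2
          measurable_compose[OF measurable_fst id])
        (auto simp: space_pair_measure space_restrict_space)
    from measurable_compose[OF this admissible_drift_jointly_measurable[OF sub _ adm]]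
    have [measurable]: "(\<lambda>p. b' (snd p) (fst p) x) \<in> borel_measurable (?L \<Otimes>\<^sub>M M)"
      if "x \<in> L2bar M F (t0 - l) (T + u)" for x
      using that pos by simp
    note [measurable] = this[OF X] this[OF Y]
    have jm: "(\<lambda>(s, w). ennreal (?G w s)) \<in> borel_measurable (?L \<Otimes>\<^sub>M M)"
      by (simp add: split_beta')
    have "(\<integral>\<^sup>+w. ennreal (X' t w - X t w) \<partial>M) \<le>
        (\<integral>\<^sup>+w. (\<integral>\<^sup>+s\<in>{t0..t}. ennreal (?G w s) \<partial>lborel) \<partial>M)"
      by (rule nn_integral_mono_AE[OF sde_solution_excess_le[OF M sub pos(1-4) hyps t]])
    also have "\<dots> = (\<integral>\<^sup>+w. (\<integral>\<^sup>+s. ennreal (?G w s) \<partial>?L) \<partial>M)"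
      by (simp add: nn_integral_restrict_space)
    also have "\<dots> = (\<integral>\<^sup>+s. (\<integral>\<^sup>+w. ennreal (?G w s) \<partial>M) \<partial>?L)"
      using P.Fubini'[OF jm] by simp
    also have "\<dots> \<le> (\<integral>\<^sup>+s. ennreal (K * N * exp (c * (s + u))) \<partial>?L)"
      using t by (intro nn_integral_mono drift) (auto simp: space_restrict_space)
    also have "\<dots> = (\<integral>\<^sup>+s. ennreal (K * N * exp (c * (s + u))) * indicator {t0..t} s \<partial>lborel)"
      by (simp add: nn_integral_restrict_space)
    also have "\<dots> = ennreal (?q * N * exp (c * t) - ?q * N * exp (c * t0))"
      using t pos
      by (intro nn_integral_FTC_Icc)
        (auto intro!: derivative_eq_intros simp: ring_distribs exp_add field_simps
          simp flip: has_real_derivative_iff_has_vector_derivative)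
    also have "\<dots> \<le> ennreal (?q * N * exp (c * t))"
      using pos by (intro ennreal_leI) auto
    finally show ?thesis .
  qed
  show ?thesis
  proof (rule excess_bound_extend[OF pos(2,3) hyps _ mid t])
    show "mono (\<lambda>t. ennreal (?q * N * exp (c * t)))"
      using pos(5-7) by (intro monoI ennreal_leI mult_left_mono) simp_all
  qed
qed

text \<open>The iteration has to start from a finite bound. The second moments of the suprema of both
  solutions provide one that is uniform in time.\<close>

lemma excess_bounded:
  assumes M: "prob_space M" and sub: "\<And>t. subalgebra M (F t)"
    and pos: "0 \<le> t0" "t0 \<le> T" "0 \<le> u" "0 \<le> l"
    and hyps: "comparison_hyps M F B T l u t0 K \<theta> \<theta>' b b' \<sigma> X X'"
  obtains C where "0 \<le> C"
    "\<And>t. t \<in> {t0-l..T+u} \<Longrightarrow> (\<integral>\<^sup>+w. ennreal (X' t w - X t w) \<partial>M) \<le> ennreal C"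
proof -
  interpret prob_space M by (rule M)
  have solX: "sde_solution M F B T l u t0 b \<sigma> \<theta> X"
    and solX': "sde_solution M F B T l u t0 b' \<sigma> \<theta>' X'"
    using hyps unfolding comparison_hyps_def unique_sde_solution_def by blast+
  define S where "S Z = (\<integral>\<^sup>+w. (SUP r\<in>{t0..T}. ennreal ((norm (restrict Z {t0..T} r w))\<^sup>2)) \<partial>M)"
    for Z :: "real \<Rightarrow> 'a \<Rightarrow> real"
  have X: "X \<in> L2bar M F (t0 - l) (T + u)" and X': "X' \<in> L2bar M F (t0 - l) (T + u)"
    using solX solX' by (auto simp: sde_solution_def)
  have S: "S X < \<infinity>" "S X' < \<infinity>"
    using solX solX' unfolding sde_solution_def S2_proc_def S_def by blast+
  have m: "X t \<in> borel_measurable M" "X' t \<in> borel_measurable M" if "t \<in> {t0..T}" for t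
  proof -
    have "t \<in> {t0-l..T+u}" using that pos by auto
    then show "X t \<in> borel_measurable M" "X' t \<in> borel_measurable M"
      using X X' pos by (auto intro!: L2bar_measurable_at[where F=F and a="t0 - l" and b="T + u"] sub)
  qed
  have sq: "(\<integral>\<^sup>+w. ennreal ((Z t w)\<^sup>2) \<partial>M) \<le> S Z" if "t \<in> {t0..T}" for Z t
    unfolding S_def using that
    by (intro nn_integral_mono SUP_upper2[of t]) auto
  have mid: "(\<integral>\<^sup>+w. ennreal (X' t w - X t w) \<partial>M) \<le> 1 + (S X' + S X)" if t: "t \<in> {t0..T}" for t
  proof -
    note [measurable] = m[OF t]
    have elem: "a - b \<le> 1 + (a\<^sup>2 + b\<^sup>2)" for a b :: real
      using zero_le_power2[of "a - 1/2"] zero_le_power2[of "b + 1/2"]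
      by (simp add: power2_eq_square algebra_simps)
    have "(\<integral>\<^sup>+w. ennreal (X' t w - X t w) \<partial>M) \<le>
        (\<integral>\<^sup>+w. 1 + (ennreal ((X' t w)\<^sup>2) + ennreal ((X t w)\<^sup>2)) \<partial>M)"
      by (intro nn_integral_mono)
        (auto intro!: ennreal_leI elem simp del: ennreal_1 simp flip: ennreal_plus ennreal_1)
    also have "\<dots> = 1 + ((\<integral>\<^sup>+w. ennreal ((X' t w)\<^sup>2) \<partial>M) + (\<integral>\<^sup>+w. ennreal ((X t w)\<^sup>2) \<partial>M))"
      by (simp add: nn_integral_add emeasure_space_1)
    also have "\<dots> \<le> 1 + (S X' + S X)"
      by (intro add_mono sq t order_refl)
    finally show ?thesis .
  qed
  have "1 + (S X' + S X) < \<top>" using S by simp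
  then obtain C where C: "0 \<le> C" "1 + (S X' + S X) = ennreal C"
    by (metis ennreal_cases less_irrefl)
  show thesis
  proof (rule that[OF C(1)])
    fix t assume "t \<in> {t0-l..T+u}"
    from excess_bound_extend[OF pos(2,3) hyps _ mid this]
    show "(\<integral>\<^sup>+w. ennreal (X' t w - X t w) \<partial>M) \<le> ennreal C"
      unfolding C(2) by (simp add: monoI)
  qed
qed

text \<open>Applying the contraction \<open>n\<close> times bounds the expected excess by a multiple of \<open>q ^ n\<close> with
  \<open>q < 1\<close>, so it is zero and the excess vanishes almost surely.\<close>

lemma comparison_if_contraction:
  assumes M: "prob_space M" and sub: "\<And>t. subalgebra M (F t)"
    and pos: "0 \<le> t0" "t0 \<le> T" "0 \<le> u" "0 \<le> l" "0 \<le> K" "0 < c"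
    and small: "K * exp (c * u) < c"
    and hyps: "comparison_hyps M F B T l u t0 K \<theta> \<theta>' b b' \<sigma> X X'"
    and t: "t \<in> {t0-l..T+u}"
  shows "AE w in M. X t w \<ge> X' t w"
proof -
  let ?E = "\<lambda>t. \<integral>\<^sup>+w. ennreal (X' t w - X t w) \<partial>M"
  define q where "q = K * exp (c * u) / c"
  have q: "0 \<le> q" "q < 1"
    using small pos(5,6) by (simp_all add: q_def divide_less_eq)
  obtain C where C: "0 \<le> C" "\<And>t. t \<in> {t0-l..T+u} \<Longrightarrow> ?E t \<le> ennreal C"
    using excess_bounded[OF M sub pos(1-4) hyps] by blast
  \<comment> \<open>The weight is smallest at the left end point, so this choice turns the constant bound into a
    weighted one.\<close>
  define N where "N = C * exp (- c * (t0 - l))"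
  have N: "0 \<le> N" using C by (simp add: N_def)
  have iter: "\<forall>t\<in>{t0-l..T+u}. ?E t \<le> ennreal (q ^ n * N * exp (c * t))" for n
  proof (induction n)
    case 0
    show ?case
    proof
      fix t assume t: "t \<in> {t0-l..T+u}"
      have "C * 1 \<le> C * exp (c * (t - (t0 - l)))"
        using C t pos by (intro mult_left_mono) auto
      also have "\<dots> = N * exp (c * t)"
        by (simp add: N_def mult.assoc algebra_simps flip: exp_add)
      finally show "?E t \<le> ennreal (q ^ 0 * N * exp (c * t))"
        using order_trans[OF C(2)[OF t]] by (simp add: ennreal_leI)
    qed
  next
    case (Suc n)
    have qN: "0 \<le> q ^ n * N" using q N by simp
    show ?case
      using excess_contraction[OF M sub pos(1-5) qN pos(6) hyps] Suc
      unfolding q_def[symmetric] by (simp add: mult.assoc)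
  qed
  have "(\<lambda>n. ennreal (q ^ n * N * exp (c * t))) \<longlonglongrightarrow> ennreal (0 * N * exp (c * t))"
    using q by (intro tendsto_intros LIMSEQ_power_zero) auto
  then have "?E t \<le> ennreal (0 * N * exp (c * t))"
    using iter t by (intro LIMSEQ_le_const) auto
  then have "?E t = 0" by simp
  moreover have "X \<in> L2bar M F (t0 - l) (T + u)" "X' \<in> L2bar M F (t0 - l) (T + u)"
    using hyps unfolding comparison_hyps_def unique_sde_solution_def sde_solution_def by blast+
  then have "X t \<in> borel_measurable M" "X' t \<in> borel_measurable M"
    using t pos by (auto intro!: L2bar_measurable_at[where F=F and a="t0 - l" and b="T + u"] sub)
  ultimately have "AE w in M. ennreal (X' t w - X t w) = 0"
    by (subst (asm) nn_integral_0_iff_AE) simp_all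
  then show ?thesis
    by eventually_elim (simp add: ennreal_eq_0_iff)
qed

section \<open>The comparison theorem\<close>

theorem proposition3p5:
  fixes M :: "'w measure" and B :: "real \<Rightarrow> 'w \<Rightarrow> real ^ 'd" and T l t0 :: real
  assumes "prob_space M" and "complete_measure M" and "brownian_motion M B"
    and "T > 0" and "l \<ge> 0" and "t0 \<in> {0..T}"
  shows "(\<forall>K2>0. \<exists>\<delta>>0. \<forall>u. 0 \<le> u \<and> u < \<delta> \<longrightarrow>
            (\<forall>\<theta> \<theta>' b b' \<sigma> X X'.
               comparison_hyps M (aug_filtration M B) B T l u t0 K2 \<theta> \<theta>' b b' \<sigma> X X' \<longrightarrow>
               (\<forall>t\<in>{t0-l..T+u}. AE w in M. X t w \<ge> X' t w))) \<and>
         (\<forall>u\<ge>0. \<exists>\<kappa>>0. \<forall>K2. 0 < K2 \<and> K2 < \<kappa> \<longrightarrow>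
            (\<forall>\<theta> \<theta>' b b' \<sigma> X X'.
               comparison_hyps M (aug_filtration M B) B T l u t0 K2 \<theta> \<theta>' b b' \<sigma> X X' \<longrightarrow>
               (\<forall>t\<in>{t0-l..T+u}. AE w in M. X t w \<ge> X' t w)))"
proof -
  have sub: "subalgebra M (aug_filtration M B t)" for t
    by (rule aug_filtration_subalgebra[OF assms(3)])
  have main: "AE w in M. X t w \<ge> X' t w"
    if "0 \<le> u" "0 < K" "0 < c" "K * exp (c * u) < c" "t \<in> {t0-l..T+u}"
      "comparison_hyps M (aug_filtration M B) B T l u t0 K \<theta> \<theta>' b b' \<sigma> X X'"
    for u K c \<theta> \<theta>' b b' \<sigma> X X' t
  proof (rule comparison_if_contraction[where F = "aug_filtration M B"])
    show "comparison_hyps M (aug_filtration M B) B T l u t0 K \<theta> \<theta>' b b' \<sigma> X X'"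
      by (rule that(6))
    show "K * exp (c * u) < c" by (rule that(4))
  qed (use assms(1,4-6) sub that(1-3,5) in simp_all)
  show ?thesis
  proof (intro conjI allI impI)
    fix K :: real assume K: "0 < K"
    have "K * exp (2 * K * u) < 2 * K" if "u < ln 2 / (2 * K)" for u
    proof -
      have "2 * K * u < ln 2" using that K by (simp add: field_simps)
      then have "exp (2 * K * u) < exp (ln 2)" by (simp only: exp_less_cancel_iff)
      then show ?thesis using K by simp
    qed
    then show "\<exists>\<delta>>0. \<forall>u. 0 \<le> u \<and> u < \<delta> \<longrightarrow>
            (\<forall>\<theta> \<theta>' b b' \<sigma> X X'.
               comparison_hyps M (aug_filtration M B) B T l u t0 K \<theta> \<theta>' b b' \<sigma> X X' \<longrightarrow>
               (\<forall>t\<in>{t0-l..T+u}. AE w in M. X t w \<ge> X' t w))"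
      using K main[of _ K "2 * K"] by (intro exI[of _ "ln 2 / (2 * K)"]) (auto simp del: atLeastAtMost_iff)
  next
    fix u :: real assume u: "0 \<le> u"
    have "K * exp (1 * u) < 1" if "K < exp (- u)" for K
      using that by (simp add: exp_minus field_simps)
    then show "\<exists>\<kappa>>0. \<forall>K2. 0 < K2 \<and> K2 < \<kappa> \<longrightarrow>
            (\<forall>\<theta> \<theta>' b b' \<sigma> X X'.
               comparison_hyps M (aug_filtration M B) B T l u t0 K2 \<theta> \<theta>' b b' \<sigma> X X' \<longrightarrow>
               (\<forall>t\<in>{t0-l..T+u}. AE w in M. X t w \<ge> X' t w))"
      using u main[of u _ 1] by (intro exI[of _ "exp (- u)"]) (auto simp del: atLeastAtMost_iff)
  qed
qed

end
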